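(* Not all Hadamard submatrices of Fourier matrices are equivalent to Fourier matrices of lower order: there exist positive integers $n<m$ and an $n\times n$ Hadamard submatrix of $\mathcal{F}_m$ that is not equivalent to $\mathcal{F}_n$. Moreover, neither the presence nor the non-presence of $\mathcal{F}_n$ in a coprime Kronecker decomposition of $\mathcal{F}_m$ implies in general that all $n\times n$ Hadamard submatrices of $\mathcal{F}_m$ are equivalent to $\mathcal{F}_n$. That is: (a) there exist positive integers $n<m$ such that $\mathcal{F}_n$ is a factor in a coprime Kronecker decomposition of $\mathcal{F}_m$ and $\mathcal{F}_m$ has an $n\times n$ Hadamard submatrix not equivalent to $\mathcal{F}_n$; and (b) there exist positive integers $n<m$ such that $\mathcal{F}_n$ is not a factor in any coprime Kronecker decomposition of $\mathcal{F}_m$ and $\mathcal{F}_m$ has an $n\times n$ Hadamard submatrix not equivalent to $\mathcal{F}_n$.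
   Context: $\mathcal{F}_m=(e^{2\pi i jk/m})_{0\le j,k\le m-1}$ is the $m\times m$ Fourier matrix. An $n\times n$ submatrix of $\mathcal{F}_m$ is a matrix $H_{J,K}=(e^{2\pi i jk/m})_{j\in J,k\in K}$ with $J,K\subseteq\{0,\ldots,m-1\}$, $|J|=|K|=n$ (rows and columns listed in increasing order). An $n\times n$ complex matrix $H$ is Hadamard if all its entries have modulus $1$ and $H^*H=HH^*=nI_n$. Two Hadamard matrices $H_1,H_2$ of the same size are equivalent if there exist permutation matrices $P_1,P_2$ and unitary diagonal matrices $D_1,D_2$ with $H_1=P_1D_1H_2D_2P_2$. A coprime Kronecker decomposition of $\mathcal{F}_m$ is an expression $\mathcal{F}_m=P_r(\mathcal{F}_{a_1}\otimes\mathcal{F}_{a_2}\otimes\cdots\otimes\mathcal{F}_{a_k})P_c$ where $m=a_1a_2\cdots a_k$ with the $a_i$ pairwise relatively prime positive integers and $P_r,P_c$ permutation matrices; its factors are the matrices $\mathcal{F}_{a_i}$. *)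

theory Defs
  imports
    "Jordan_Normal_Form.Schur_Decomposition"
    "Jordan_Normal_Form.DL_Submatrix"
    "HOL-Combinatorics.Permutations"
    "HOL.Complex"
    "HOL.Transcendental"
begin

definition fourier_mat :: "nat \<Rightarrow> complex mat" where
  "fourier_mat m =
     mat m m (\<lambda>(j, k). exp (2 * complex_of_real pi * \<i> * of_nat (j * k) / of_nat m))"

definition hadamard_mat :: "nat \<Rightarrow> complex mat \<Rightarrow> bool" where
  "hadamard_mat n H \<longleftrightarrow>
     H \<in> carrier_mat n n \<and>
     (\<forall>i<n. \<forall>j<n. cmod (H $$ (i, j)) = 1) \<and>
     mat_adjoint H * H = of_nat n \<cdot>\<^sub>m 1\<^sub>m n \<and>
     H * mat_adjoint H = of_nat n \<cdot>\<^sub>m 1\<^sub>m n"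

definition permutation_mat :: "nat \<Rightarrow> complex mat \<Rightarrow> bool" where
  "permutation_mat n P \<longleftrightarrow>
     (\<exists>\<sigma>. \<sigma> permutes {..<n} \<and> P = mat n n (\<lambda>(i, j). if i = \<sigma> j then 1 else 0))"

definition unitary_diagonal_mat :: "nat \<Rightarrow> complex mat \<Rightarrow> bool" where
  "unitary_diagonal_mat n D \<longleftrightarrow>
     D \<in> carrier_mat n n \<and> diagonal_mat D \<and>
     mat_adjoint D * D = 1\<^sub>m n \<and> D * mat_adjoint D = 1\<^sub>m n"

text \<open>Equivalence is only meant for Hadamard matrices of order \<open>n\<close>. That hypothesis is not part of
  the definition, so that non-equivalence always means that no such factorization exists.\<close>

definition hadamard_equivalent :: "nat \<Rightarrow> complex mat \<Rightarrow> complex mat \<Rightarrow> bool" where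
  "hadamard_equivalent n H1 H2 \<longleftrightarrow>
     (\<exists>P1 P2 D1 D2. permutation_mat n P1 \<and> permutation_mat n P2 \<and>
        unitary_diagonal_mat n D1 \<and> unitary_diagonal_mat n D2 \<and>
        H1 = P1 * D1 * H2 * D2 * P2)"

text \<open>\<^const>\<open>submatrix\<close> lists the selected rows and columns in increasing order and keeps only
  indices within the matrix dimensions.\<close>

definition hadamard_submatrix_of_fourier :: "nat \<Rightarrow> nat \<Rightarrow> complex mat \<Rightarrow> bool" where
  "hadamard_submatrix_of_fourier n m H \<longleftrightarrow>
     (\<exists>J K. J \<subseteq> {..<m} \<and> K \<subseteq> {..<m} \<and> card J = n \<and> card K = n \<and>
        H = submatrix (fourier_mat m) J K) \<and>
     hadamard_mat n H"

definition kronecker :: "complex mat \<Rightarrow> complex mat \<Rightarrow> complex mat" where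
  "kronecker A B =
     mat (dim_row A * dim_row B) (dim_col A * dim_col B)
       (\<lambda>(i, j). A $$ (i div dim_row B, j div dim_col B) * B $$ (i mod dim_row B, j mod dim_col B))"

definition kronecker_list :: "complex mat list \<Rightarrow> complex mat" where
  "kronecker_list As = foldr kronecker As (1\<^sub>m 1)"

text \<open>The list \<open>as\<close> consists of the orders of the factors of the decomposition. A factor of
  order \<open>1\<close> is permitted, as every \<open>a\<^sub>i\<close> is only required to be positive.\<close>

definition coprime_kronecker_decomposition :: "nat \<Rightarrow> nat list \<Rightarrow> bool" where
  "coprime_kronecker_decomposition m as \<longleftrightarrow>
     as \<noteq> [] \<and> (\<forall>a \<in> set as. a > 0) \<and>
     (\<forall>i < length as. \<forall>j < length as. i \<noteq> j \<longrightarrow> coprime (as ! i) (as ! j)) \<and>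
     m = prod_list as \<and>
     (\<exists>Pr Pc. permutation_mat m Pr \<and> permutation_mat m Pc \<and>
        fourier_mat m = Pr * kronecker_list (map fourier_mat as) * Pc)"

definition factor_in_decomposition :: "nat \<Rightarrow> nat list \<Rightarrow> bool" where
  "factor_in_decomposition n as \<longleftrightarrow> fourier_mat n \<in> set (map fourier_mat as)"

end

theory Submission
  imports Defs "HOL-Number_Theory.Cong"
begin

text \<open>
  For a complex number \<open>z\<close> of modulus \<open>1\<close> let \<open>H(z)\<close> be the matrix with rows \<open>(1, 1, 1, 1)\<close>,
  \<open>(1, z, -1, -z)\<close>, \<open>(1, -1, 1, -1)\<close> and \<open>(1, -z, -1, z)\<close>. It is Hadamard for every such \<open>z\<close>, and
  \<open>H(\<i>)\<close> is the Fourier matrix of order \<open>4\<close>.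

  These matrices occur inside Fourier matrices: if \<open>m = 2 h\<close> with \<open>h\<close> even, then the rows and the
  columns \<open>0, 1, h, h + 1\<close> of the Fourier matrix of order \<open>m\<close> form \<open>H(\<omega>)\<close> with
  \<open>\<omega> = exp (2 \<pi> \<i> / m)\<close>, since \<open>\<omega>\<^sup>h = -1\<close> and \<open>h\<^sup>2\<close> is a multiple of \<open>m\<close>.

  They are told apart from the Fourier matrix of order \<open>n = 4\<close> by raising every entry to the
  \<open>n\<close>-th power. All entries of the Fourier matrix of order \<open>n\<close> are \<open>n\<close>-th roots of unity, so its
  entrywise power is the all-ones matrix. Permutations and diagonal matrices then only turn it into
  another matrix of the form \<open>u\<^sub>i v\<^sub>j\<close>, all of whose \<open>2 \<times> 2\<close> minors vanish
  (lemma \<open>hadamard_equivalent_fourier_minor\<close>). The upper left minor of the entrywise fourth power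
  of \<open>H(z)\<close> is \<open>z\<^sup>4 - 1\<close>, and \<open>\<omega>\<^sup>4 \<noteq> 1\<close> as soon as \<open>m > 4\<close>. Hence every multiple \<open>m > 4\<close> of \<open>4\<close>
  gives an example of order \<open>4\<close>.

  Now take \<open>m = 12\<close> and \<open>m = 8\<close>. As \<open>4\<close> and \<open>3\<close> are coprime, the Chinese remainder theorem
  provides the decomposition of order \<open>12 = 4 \<cdot> 3\<close>, in which \<open>4\<close> appears. In order \<open>8\<close> the
  complementary factor of \<open>4\<close> would be \<open>2\<close>, which is not coprime to \<open>4\<close>.
\<close>

section \<open>Fourier matrices as powers of a root of unity\<close>

definition unity_root :: "nat \<Rightarrow> complex" where
  "unity_root m = cis (2 * pi / of_nat m)"

lemma unity_root_power: "unity_root m ^ k = cis (2 * pi * of_nat k / of_nat m)"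
  by (simp add: unity_root_def DeMoivre mult.commute)

lemma unity_root_power_order: "m > 0 \<Longrightarrow> unity_root m ^ m = 1"
  by (simp add: unity_root_power)

lemma unity_root_power_mod: 
  assumes "m > 0"
  shows "unity_root m ^ (k mod m) = unity_root m ^ k"
proof -
  have "unity_root m ^ k = unity_root m ^ (m * (k div m) + k mod m)" by simp
  also have "\<dots> = unity_root m ^ (k mod m)"
    unfolding power_add power_mult unity_root_power_order[OF assms] by simp
  finally show ?thesis by simp
qed

lemma unity_root_power_cofactor: "b > 0 \<Longrightarrow> unity_root (a * b) ^ b = unity_root a"
  unfolding unity_root_power by (simp add: unity_root_def)

lemma unity_root_power_half: "h > 0 \<Longrightarrow> unity_root (2 * h) ^ h = -1"
  using unity_root_power_cofactor[of h 2] by (simp add: unity_root_def)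

lemma cmod_unity_root: "cmod (unity_root m) = 1"
  by (simp add: unity_root_def)

lemma unity_root_power_neq_1:
  assumes "0 < k" "k < m"
  shows "unity_root m ^ k \<noteq> 1"
proof
  assume "unity_root m ^ k = 1"
  then have "cos (2 * pi * (real k / real m)) = 1"
    by (simp add: unity_root_power cis.ctr complex_eq_iff)
  then obtain n :: int where "2 * pi * (real k / real m) = of_int n * (2 * pi)"
    unfolding cos_one_2pi_int by auto
  then have "2 * pi * (real k / real m) = 2 * pi * of_int n" by (simp only: mult.commute)
  then have n: "real k / real m = of_int n" by (subst (asm) mult_cancel_left) simp
  have "0 < real k / real m" "real k / real m < 1"
    using assms by auto
  then show False unfolding n by simp
qed

lemma fourier_mat_carrier [simp]: "fourier_mat m \<in> carrier_mat m m"
  by (simp add: fourier_mat_def)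

lemma fourier_mat_index:
  assumes "j < m" "k < m"
  shows "fourier_mat m $$ (j, k) = unity_root m ^ (j * k)"
  using assms
  by (simp add: fourier_mat_def unity_root_power cis_conv_exp mult_ac)

section \<open>An obstruction to equivalence with a Fourier matrix\<close>

lemma permutation_mat_mult_left:
  assumes s: "\<sigma> permutes {..<n}" and A: "A \<in> carrier_mat n n" and "i < n" "j < n"
  shows "(mat n n (\<lambda>(i, j). if i = \<sigma> j then 1 else 0) * A) $$ (\<sigma> i, j) 
           = (A $$ (i, j) :: complex)"
proof -
  have "\<sigma> i < n" using permutes_in_image[OF s, of i] \<open>i < n\<close> by simp
  then have "(mat n n (\<lambda>(i, j). if i = \<sigma> j then 1 else 0) * A) $$ (\<sigma> i, j)
      = (\<Sum>l<n. (if \<sigma> i = \<sigma> l then 1 else 0) * A $$ (l, j))"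
    using assms by (simp add: scalar_prod_def atLeast0LessThan)
  also have "\<dots> = (\<Sum>l<n. if l = i then A $$ (l, j) else 0)"
    by (rule sum.cong) (auto simp: inj_eq[OF permutes_inj[OF s]])
  also have "\<dots> = A $$ (i, j)" using \<open>i < n\<close> by simp
  finally show ?thesis .
qed

lemma permutation_mat_mult_right:
  assumes s: "\<sigma> permutes {..<n}" and A: "A \<in> carrier_mat n n" and "i < n" "j < n"
  shows "(A * mat n n (\<lambda>(i, j). if i = \<sigma> j then 1 else 0)) $$ (i, j) 
           = (A $$ (i, \<sigma> j) :: complex)"
proof -
  have "\<sigma> j < n" using permutes_in_image[OF s, of j] \<open>j < n\<close> by simp
  have "(A * mat n n (\<lambda>(i, j). if i = \<sigma> j then 1 else 0)) $$ (i, j)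
      = (\<Sum>l<n. A $$ (i, l) * (if l = \<sigma> j then 1 else 0))"
    using assms by (simp add: scalar_prod_def atLeast0LessThan)
  also have "\<dots> = (\<Sum>l<n. if l = \<sigma> j then A $$ (i, l) else 0)"
    by (rule sum.cong) auto
  also have "\<dots> = A $$ (i, \<sigma> j)" using \<open>\<sigma> j < n\<close> by simp
  finally show ?thesis .
qed

lemma diagonal_mat_mult_left:
  assumes D: "D \<in> carrier_mat n n" "diagonal_mat D" and A: "A \<in> carrier_mat n n" 
    and "i < n" "j < n"
  shows "(D * A) $$ (i, j) = D $$ (i, i) * (A $$ (i, j) :: complex)"
proof -
  have "(D * A) $$ (i, j) = (\<Sum>l<n. D $$ (i, l) * A $$ (l, j))"
    using assms by (simp add: scalar_prod_def atLeast0LessThan)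
  also have "\<dots> = (\<Sum>l<n. if l = i then D $$ (i, i) * A $$ (i, j) else 0)"
    using assms by (intro sum.cong) (auto simp: diagonal_mat_def)
  also have "\<dots> = D $$ (i, i) * A $$ (i, j)" using \<open>i < n\<close> by simp
  finally show ?thesis .
qed

lemma diagonal_mat_mult_right:
  assumes D: "D \<in> carrier_mat n n" "diagonal_mat D" and A: "A \<in> carrier_mat n n" 
    and "i < n" "j < n"
  shows "(A * D) $$ (i, j) = (A $$ (i, j) :: complex) * D $$ (j, j)"
proof -
  have "(A * D) $$ (i, j) = (\<Sum>l<n. A $$ (i, l) * D $$ (l, j))"
    using assms by (simp add: scalar_prod_def atLeast0LessThan)
  also have "\<dots> = (\<Sum>l<n. if l = j then A $$ (i, j) * D $$ (j, j) else 0)"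
    using assms by (intro sum.cong) (auto simp: diagonal_mat_def)
  also have "\<dots> = A $$ (i, j) * D $$ (j, j)" using \<open>j < n\<close> by simp
  finally show ?thesis .
qed

lemma hadamard_equivalent_entries:
  assumes "hadamard_equivalent n H1 H2" and H2: "H2 \<in> carrier_mat n n"
  obtains \<sigma> \<tau> d e where "\<sigma> permutes {..<n}" "\<tau> permutes {..<n}"
    "\<And>i j. i < n \<Longrightarrow> j < n \<Longrightarrow> H1 $$ (\<sigma> i, j) = d i * H2 $$ (i, \<tau> j) * e j"
proof -
  from assms obtain P1 P2 D1 D2 where P: "permutation_mat n P1" "permutation_mat n P2"
    and D: "unitary_diagonal_mat n D1" "unitary_diagonal_mat n D2"
    and H1: "H1 = P1 * D1 * H2 * D2 * P2"
    unfolding hadamard_equivalent_def by auto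
  from P obtain \<sigma> \<tau> where s: "\<sigma> permutes {..<n}" and t: "\<tau> permutes {..<n}"
    and P1: "P1 = mat n n (\<lambda>(i, j). if i = \<sigma> j then 1 else 0)"
    and P2: "P2 = mat n n (\<lambda>(i, j). if i = \<tau> j then 1 else 0)"
    unfolding permutation_mat_def by auto
  have D1: "D1 \<in> carrier_mat n n" "diagonal_mat D1" 
    and D2: "D2 \<in> carrier_mat n n" "diagonal_mat D2"
    using D unfolding unitary_diagonal_mat_def by auto
  have cP: "P1 \<in> carrier_mat n n" "P2 \<in> carrier_mat n n" unfolding P1 P2 by auto
  have "H1 = P1 * (D1 * (H2 * D2)) * P2"
    unfolding H1 using cP D1(1) D2(1) H2
    by (simp add: assoc_mult_mat[of _ n n _ n _ n])
  moreover have "(P1 * (D1 * (H2 * D2)) * P2) $$ (\<sigma> i, j)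
      = D1 $$ (i, i) * H2 $$ (i, \<tau> j) * D2 $$ (\<tau> j, \<tau> j)" if "i < n" "j < n" for i j
  proof -
    have "\<sigma> i < n" using permutes_in_image[OF s, of i] that by simp
    have "\<tau> j < n" using permutes_in_image[OF t, of j] that by simp
    have "(P1 * (D1 * (H2 * D2)) * P2) $$ (\<sigma> i, j) = (P1 * (D1 * (H2 * D2))) $$ (\<sigma> i, \<tau> j)"
      unfolding P2 using cP D1(1) D2(1) H2 that \<open>\<sigma> i < n\<close>
      by (intro permutation_mat_mult_right[OF t]) auto
    also have "\<dots> = (D1 * (H2 * D2)) $$ (i, \<tau> j)"
      unfolding P1 using D1(1) D2(1) H2 that \<open>\<tau> j < n\<close>
      by (intro permutation_mat_mult_left[OF s]) auto
    also have "\<dots> = D1 $$ (i, i) * (H2 * D2) $$ (i, \<tau> j)"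
      using D1 D2(1) H2 that \<open>\<tau> j < n\<close> by (intro diagonal_mat_mult_left[where n = n]) auto
    also have "(H2 * D2) $$ (i, \<tau> j) = H2 $$ (i, \<tau> j) * D2 $$ (\<tau> j, \<tau> j)"
      using D2 H2 that \<open>\<tau> j < n\<close> by (intro diagonal_mat_mult_right[where n = n]) auto
    finally show ?thesis by (simp add: mult.assoc)
  qed
  ultimately show ?thesis
    using that[OF s t, of "\<lambda>i. D1 $$ (i, i)" "\<lambda>j. D2 $$ (\<tau> j, \<tau> j)"] by simp
qed

text \<open>
  Entrywise \<open>n\<close>-th powers annihilate the contribution of the Fourier matrix, so what remains are
  the powers of the diagonal entries, a matrix of rank one.
\<close>

lemma hadamard_equivalent_fourier_minor:
  assumes "hadamard_equivalent n H (fourier_mat n)"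
    and "i < n" "i' < n" "j < n" "j' < n"
  shows "(H $$ (i, j) * H $$ (i', j')) ^ n = (H $$ (i, j') * H $$ (i', j)) ^ n"
proof -
  have "n > 0" using assms by simp
  obtain \<sigma> \<tau> d e where s: "\<sigma> permutes {..<n}" and t: "\<tau> permutes {..<n}"
    and H: "\<And>i j. i < n \<Longrightarrow> j < n \<Longrightarrow> H $$ (\<sigma> i, j) = d i * fourier_mat n $$ (i, \<tau> j) * e j"
    using hadamard_equivalent_entries[OF assms(1) fourier_mat_carrier] by blast
  have pow: "H $$ (i, j) ^ n = d (inv_into UNIV \<sigma> i) ^ n * e j ^ n" if "i < n" "j < n" for i j
  proof -
    have "inv_into UNIV \<sigma> i < n" "\<tau> j < n"
      using permutes_in_image[OF permutes_inv[OF s], of i] permutes_in_image[OF t, of j] that 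
      by auto
    then have "fourier_mat n $$ (inv_into UNIV \<sigma> i, \<tau> j) ^ n = 1"
      using unity_root_power_order[OF \<open>n > 0\<close>]
      by (simp add: fourier_mat_index power_mult[symmetric] mult.commute[of _ n])
         (simp add: power_mult)
    then show ?thesis
      using H[OF \<open>inv_into UNIV \<sigma> i < n\<close> \<open>j < n\<close>] permutes_inverses(1)[OF s] 
      by (simp add: power_mult_distrib)
  qed
  show ?thesis using assms by (simp add: power_mult_distrib pow)
qed

section \<open>A circle of Hadamard matrices of order four\<close>

definition hadamard4 :: "complex \<Rightarrow> complex mat" where
  "hadamard4 z = mat_of_rows_list 4
     [[1, 1, 1, 1], [1, z, -1, -z], [1, -1, 1, -1], [1, -z, -1, z]]"

lemma less_4_cases: "(i :: nat) < 4 \<longleftrightarrow> i = 0 \<or> i = 1 \<or> i = 2 \<or> i = 3"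
  by auto

lemma lessThan_4: "{..<4} = {0, 1, 2, 3 :: nat}"
  by auto

lemma mat_adjoint_index:
  assumes "A \<in> carrier_mat n n" "i < n" "j < n"
  shows "mat_adjoint A $$ (i, j) = cnj (A $$ (j, i))"
  using assms by (simp add: mat_adjoint_def mat_of_rows_def)

lemma mat_adjoint_carrier:
  assumes "A \<in> carrier_mat n n"
  shows "mat_adjoint (A :: complex mat) \<in> carrier_mat n n"
  using assms by (simp add: mat_adjoint_def mat_of_rows_def)

lemma hadamard_mat_hadamard4:
  assumes "cmod z = 1"
  shows "hadamard_mat 4 (hadamard4 z)"
proof -
  have C: "hadamard4 z \<in> carrier_mat 4 4"
    by (rule carrier_matI) (simp_all add: hadamard4_def mat_of_rows_list_def)
  note C' = mat_adjoint_carrier[OF C]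
  have z: "cnj z * z = 1" "z * cnj z = 1"
    using assms complex_norm_square[of z] by (simp_all add: mult.commute)
  have entries: "cmod (hadamard4 z $$ (i, j)) = 1" if "i < 4" "j < 4" for i j
    using that assms by (auto simp: less_4_cases hadamard4_def mat_of_rows_list_def)
  have "(mat_adjoint (hadamard4 z) * hadamard4 z) $$ (i, j) = (of_nat 4 \<cdot>\<^sub>m 1\<^sub>m 4) $$ (i, j)"
    if "i < 4" "j < 4" for i j
  proof -
    have "(mat_adjoint (hadamard4 z) * hadamard4 z) $$ (i, j)
        = (\<Sum>l<4. cnj (hadamard4 z $$ (l, i)) * hadamard4 z $$ (l, j))"
      using C C' that by (simp add: scalar_prod_def atLeast0LessThan mat_adjoint_index[OF C])
    also have "\<dots> = (of_nat 4 \<cdot>\<^sub>m 1\<^sub>m 4) $$ (i, j)"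
      using that z unfolding less_4_cases
      by (auto simp: lessThan_4 hadamard4_def mat_of_rows_list_def)
    finally show ?thesis .
  qed
  then have 1: "mat_adjoint (hadamard4 z) * hadamard4 z = of_nat 4 \<cdot>\<^sub>m 1\<^sub>m 4"
    using C C' by (intro eq_matI) auto
  have "(hadamard4 z * mat_adjoint (hadamard4 z)) $$ (i, j) = (of_nat 4 \<cdot>\<^sub>m 1\<^sub>m 4) $$ (i, j)"
    if "i < 4" "j < 4" for i j
  proof -
    have "(hadamard4 z * mat_adjoint (hadamard4 z)) $$ (i, j)
        = (\<Sum>l<4. hadamard4 z $$ (i, l) * cnj (hadamard4 z $$ (j, l)))"
      using C C' that by (simp add: scalar_prod_def atLeast0LessThan mat_adjoint_index[OF C])
    also have "\<dots> = (of_nat 4 \<cdot>\<^sub>m 1\<^sub>m 4) $$ (i, j)"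
      using that z unfolding less_4_cases
      by (auto simp: lessThan_4 hadamard4_def mat_of_rows_list_def)
    finally show ?thesis .
  qed
  then have "hadamard4 z * mat_adjoint (hadamard4 z) = of_nat 4 \<cdot>\<^sub>m 1\<^sub>m 4"
    using C C' by (intro eq_matI) auto
  with C entries 1 show ?thesis unfolding hadamard_mat_def by blast
qed

lemma hadamard4_not_equivalent_fourier:
  assumes "z ^ 4 \<noteq> 1"
  shows "\<not> hadamard_equivalent 4 (hadamard4 z) (fourier_mat 4)"
proof
  assume "hadamard_equivalent 4 (hadamard4 z) (fourier_mat 4)"
  from hadamard_equivalent_fourier_minor[OF this, of 0 1 0 1] have "z ^ 4 = 1"
    by (simp add: hadamard4_def mat_of_rows_list_def)
  with assms show False by simp
qed

lemma pick_two_adjacent_pairs: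
  assumes "h \<ge> 2" "i < 4"
  shows "pick {0, 1, h, h + 1} i = [0, 1, h, h + 1] ! i"
proof -
  have "pick {0, 1, h, h + 1} 0 = 0"
    by (simp add: Least_eq_0)
  moreover from this have "pick {0, 1, h, h + 1} 1 = 1"
    using assms unfolding One_nat_def pick.simps(2) by (intro Least_equality) auto
  moreover from this have "pick {0, 1, h, h + 1} 2 = h"
    using assms unfolding numeral_2_eq_2 pick.simps(2) One_nat_def by (intro Least_equality) auto
  moreover from this have "pick {0, 1, h, h + 1} 3 = h + 1"
    using assms unfolding numeral_3_eq_3 numeral_2_eq_2 pick.simps(2)[of _ "Suc (Suc 0)"] 
    by (intro Least_equality) auto
  ultimately show ?thesis
    using assms(2) unfolding less_4_cases by auto
qed

text \<open>
  The sixteen entries reduce to \<open>\<omega>\<^sup>h = -1\<close>. Evenness of \<open>h\<close> enters through the product \<open>h \<cdot> h\<close> of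
  a row and a column index, for which it gives \<open>\<omega> ^ (h \<cdot> h) = (-1)\<^sup>h = 1\<close>.
\<close>

lemma submatrix_fourier_hadamard4:
  assumes "even h" "h > 0"
  defines "S \<equiv> {0, 1, h, h + 1}"
  shows "submatrix (fourier_mat (2 * h)) S S = hadamard4 (unity_root (2 * h))"
proof -
  define w where "w = unity_root (2 * h)"
  have h2: "h \<ge> 2" using assms(1,2) by presburger
  have half: "w ^ h = -1" using unity_root_power_half assms(2) by (simp add: w_def)
  have sq: "w ^ (h * h) = 1" using assms(1) by (simp add: power_mult half)
  have S: "S \<subseteq> {..<2 * h}" "card S = 4" using h2 by (auto simp: S_def)
  have dim: "dim_row (fourier_mat (2 * h)) = 2 * h" "dim_col (fourier_mat (2 * h)) = 2 * h"
    by (simp_all add: fourier_mat_def)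
  have card: "card {i. i < 2 * h \<and> i \<in> S} = 4"
    using S by (metis (mono_tags, lifting) Collect_cong Collect_mem_eq lessThan_iff subsetD)
  show ?thesis
  proof (rule eq_matI)
    fix i j assume "i < dim_row (hadamard4 (unity_root (2 * h)))"
      "j < dim_col (hadamard4 (unity_root (2 * h)))"
    then have ij: "i < 4" "j < 4" by (simp_all add: hadamard4_def mat_of_rows_list_def)
    have lt: "[0, 1, h, h + 1] ! i < 2 * h" if "i < 4" for i
      using that h2 unfolding less_4_cases by auto
    have "submatrix (fourier_mat (2 * h)) S S $$ (i, j)
        = fourier_mat (2 * h) $$ ([0, 1, h, h + 1] ! i, [0, 1, h, h + 1] ! j)"
      using ij by (simp add: submatrix_index dim card S_def[symmetric] 
          pick_two_adjacent_pairs[OF h2, folded S_def])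
    also have "\<dots> = w ^ ([0, 1, h, h + 1] ! i * [0, 1, h, h + 1] ! j)"
      unfolding w_def using lt ij by (intro fourier_mat_index) auto
    also have "\<dots> = hadamard4 w $$ (i, j)"
      using ij unfolding less_4_cases 
      by (auto simp: hadamard4_def mat_of_rows_list_def distrib_left distrib_right power_add
          half sq)
    finally show "submatrix (fourier_mat (2 * h)) S S $$ (i, j)
        = hadamard4 (unity_root (2 * h)) $$ (i, j)" by (simp add: w_def)
  qed (simp_all add: dim_submatrix dim card hadamard4_def mat_of_rows_list_def)
qed

lemma inequivalent_submatrix_order_4:
  assumes "4 dvd m" "m > 4"
  shows "\<exists>H. hadamard_submatrix_of_fourier 4 m H \<and> \<not> hadamard_equivalent 4 H (fourier_mat 4)"
proof -
  obtain h where m: "m = 2 * h" "even h" "h > 2"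
  proof
    show "m = 2 * (m div 2)" "even (m div 2)" "m div 2 > 2" using assms by presburger+
  qed
  define S where "S = {0, 1, h, h + 1}"
  have S: "S \<subseteq> {..<m}" "card S = 4" using m by (auto simp: S_def)
  have "submatrix (fourier_mat m) S S = hadamard4 (unity_root m)"
    using submatrix_fourier_hadamard4[of h] m by (simp add: S_def)
  moreover have "hadamard_mat 4 (hadamard4 (unity_root m))"
    by (rule hadamard_mat_hadamard4[OF cmod_unity_root])
  ultimately have "hadamard_submatrix_of_fourier 4 m (hadamard4 (unity_root m))"
    unfolding hadamard_submatrix_of_fourier_def using S by metis
  with hadamard4_not_equivalent_fourier[OF unity_root_power_neq_1, of m] assms(2)
  show ?thesis by auto
qed

section \<open>Coprime Kronecker decompositions\<close>

lemma kronecker_one_right: "kronecker A (1\<^sub>m 1) = A"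
  by (rule eq_matI) (auto simp: kronecker_def)

lemma index_pair_less:
  fixes a b :: nat
  assumes "i < a" "j < b"
  shows "i * b + j < a * b"
proof -
  have "i * b + j < Suc i * b" using assms by simp
  also have "\<dots> \<le> a * b" using assms by (intro mult_le_mono1) simp
  finally show ?thesis .
qed

lemma permutes_if_inj_on:
  fixes f :: "nat \<Rightarrow> nat"
  assumes "inj_on f {..<n}" "\<And>i. i < n \<Longrightarrow> f i < n"
  shows "(\<lambda>i. if i < n then f i else i) permutes {..<n}"
proof (rule bij_imp_permutes)
  have "f ` {..<n} = {..<n}"
    using assms by (intro endo_inj_surj) auto
  with assms(1) have "bij_betw f {..<n} {..<n}" by (simp add: bij_betw_def)
  then show "bij_betw (\<lambda>i. if i < n then f i else i) {..<n} {..<n}"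
    by (subst bij_betw_cong[where g = f]) auto
qed simp

text \<open>
  Both index sets have \<open>a b\<close> elements, but they are matched with pairs in different ways: the
  column \<open>k\<close> is sent to the pair of its residues, while the row \<open>(i\<^sub>1, i\<^sub>2)\<close> is sent to
  \<open>b i\<^sub>1 + a i\<^sub>2\<close>. Then the exponent splits as
  \<open>(b i\<^sub>1 + a i\<^sub>2) k / (a b) = i\<^sub>1 k / a + i\<^sub>2 k / b\<close> without mixed terms. Coprimality is
  what makes these two maps injective.
\<close>

lemma fourier_mat_coprime_kronecker:
  assumes "coprime a b" "a > 0" "b > 0"
  shows "\<exists>Pr Pc. permutation_mat (a * b) Pr \<and> permutation_mat (a * b) Pc \<and>
           fourier_mat (a * b) = Pr * kronecker (fourier_mat a) (fourier_mat b) * Pc"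
proof -
  let ?n = "a * b"
  define row where "row = (\<lambda>i. (b * (i div b) + a * (i mod b)) mod ?n)"
  define col where "col = (\<lambda>k. (k mod a) * b + k mod b)"
  define \<sigma> where "\<sigma> = (\<lambda>i. if i < ?n then row i else i)"
  define \<tau> where "\<tau> = (\<lambda>k. if k < ?n then col k else k)"
  have n: "?n > 0" using assms by simp
  have div_less: "i div b < a" if "i < ?n" for i
    using that assms by (simp add: less_mult_imp_div_less)
  have s: "\<sigma> permutes {..<?n}" unfolding \<sigma>_def
  proof (rule permutes_if_inj_on)
    show "inj_on row {..<?n}"
    proof (rule inj_onI)
      fix i j assume ij: "i \<in> {..<?n}" "j \<in> {..<?n}" and "row i = row j"
      then have eq: "[b * (i div b) + a * (i mod b) = b * (j div b) + a * (j mod b)] (mod a * b)"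
        by (simp add: row_def cong_def)
      \<comment> \<open>Modulo \<open>a\<close> only the first summand survives, modulo \<open>b\<close> only the second one.\<close>
      have "[b * (i div b) = b * (j div b)] (mod a)"
        using cong_modulus_mult_nat[OF eq] by (simp add: cong_def)
      then have "[i div b = j div b] (mod a)"
        using assms(1) by (simp add: cong_mult_lcancel_nat coprime_commute)
      then have "i div b = j div b"
        using ij div_less by (simp add: cong_def)
      moreover have "[a * (i mod b) = a * (j mod b)] (mod b)"
        using cong_modulus_mult_nat[OF eq[unfolded mult.commute[of a b]]] by (simp add: cong_def)
      then have "[i mod b = j mod b] (mod b)"
        using assms(1) by (simp add: cong_mult_lcancel_nat)
      then have "i mod b = j mod b" by (simp add: cong_def)
      ultimately show "i = j" by (metis div_mult_mod_eq)
    qed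
  qed (use n in \<open>simp add: row_def\<close>)
  have t: "\<tau> permutes {..<?n}" unfolding \<tau>_def
  proof (rule permutes_if_inj_on)
    show "inj_on col {..<?n}"
    proof (rule inj_onI)
      fix i j assume ij: "i \<in> {..<?n}" "j \<in> {..<?n}" and eq: "col i = col j"
      have "col i div b = i mod a" "col j div b = j mod a"
        "col i mod b = i mod b" "col j mod b = j mod b"
        using assms(3) by (simp_all add: col_def)
      with eq have "[i = j] (mod a)" "[i = j] (mod b)" by (simp_all add: cong_def)
      then have "[i = j] (mod a * b)" using assms(1) by (rule coprime_cong_mult_nat)
      then show "i = j" using ij by (simp add: cong_def)
    qed
  qed (use assms in \<open>simp add: col_def index_pair_less\<close>)
  define K where "K = kronecker (fourier_mat a) (fourier_mat b)"
  have dims [simp]: "dim_row (fourier_mat k) = k" "dim_col (fourier_mat k) = k" for k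
    by (simp_all add: fourier_mat_def)
  have K: "K \<in> carrier_mat ?n ?n" by (simp add: K_def kronecker_def)
  define Pr :: "complex mat" where "Pr = mat ?n ?n (\<lambda>(i, j). if i = \<sigma> j then 1 else 0)"
  define Pc :: "complex mat" where "Pc = mat ?n ?n (\<lambda>(i, j). if i = \<tau> j then 1 else 0)"
  have P: "Pr \<in> carrier_mat ?n ?n" "Pc \<in> carrier_mat ?n ?n" by (simp_all add: Pr_def Pc_def)
  have entry: "fourier_mat ?n $$ (\<sigma> i, k) = (Pr * K * Pc) $$ (\<sigma> i, k)"
    if ik: "i < ?n" "k < ?n" for i k
  proof -
    have lt: "\<sigma> i < ?n" "\<tau> k < ?n"
      using permutes_in_image[OF s, of i] permutes_in_image[OF t, of k] ik by auto
    have "fourier_mat ?n $$ (\<sigma> i, k) = unity_root ?n ^ (row i * k)"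
      using fourier_mat_index[OF lt(1) ik(2)] ik by (simp add: \<sigma>_def)
    also have "\<dots> = unity_root ?n ^ (row i * k mod ?n)"
      by (rule unity_root_power_mod[OF n, symmetric])
    also have "row i * k mod ?n = (b * (i div b * k) + a * (i mod b * k)) mod ?n"
      unfolding row_def mod_mult_left_eq by (simp add: algebra_simps)
    also have "unity_root ?n ^ \<dots> = unity_root ?n ^ (b * (i div b * k) + a * (i mod b * k))"
      by (rule unity_root_power_mod[OF n])
    also have "\<dots> = unity_root a ^ (i div b * k) * unity_root b ^ (i mod b * k)"
      using unity_root_power_cofactor[of b a] unity_root_power_cofactor[of a b] assms
      by (simp add: power_add power_mult mult.commute[of b a])
    also have "\<dots> = unity_root a ^ (i div b * (k mod a)) * unity_root b ^ (i mod b * (k mod b))"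
      using unity_root_power_mod[OF assms(2), of "i div b * k"]
        unity_root_power_mod[OF assms(2), of "i div b * (k mod a)"]
        unity_root_power_mod[OF assms(3), of "i mod b * k"]
        unity_root_power_mod[OF assms(3), of "i mod b * (k mod b)"]
      by (simp add: mod_mult_right_eq)
    also have "\<dots> = K $$ (i, col k)"
      using ik assms div_less[OF ik(1)] index_pair_less[of "k mod a" a "k mod b" b]
      by (simp add: K_def kronecker_def col_def fourier_mat_index)
    also have "\<dots> = K $$ (i, \<tau> k)" using ik by (simp add: \<tau>_def)
    also have "\<dots> = (Pr * K) $$ (\<sigma> i, \<tau> k)"
      unfolding Pr_def by (rule permutation_mat_mult_left[OF s K ik(1) lt(2), symmetric])
    also have "\<dots> = (Pr * K * Pc) $$ (\<sigma> i, k)"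
      unfolding Pc_def using P K lt ik
      by (intro permutation_mat_mult_right[OF t, symmetric]) auto
    finally show ?thesis .
  qed
  have "fourier_mat ?n = Pr * K * Pc"
  proof (rule eq_matI)
    fix j k assume "j < dim_row (Pr * K * Pc)" "k < dim_col (Pr * K * Pc)"
    then have jk: "j < ?n" "k < ?n" using P by auto
    then have "inv_into UNIV \<sigma> j < ?n" using permutes_in_image[OF permutes_inv[OF s], of j] by simp
    from entry[OF this jk(2)] show "fourier_mat ?n $$ (j, k) = (Pr * K * Pc) $$ (j, k)"
      by (simp add: permutes_inverses(1)[OF s])
  qed (use P in auto)
  moreover have "permutation_mat ?n Pr" "permutation_mat ?n Pc"
    unfolding permutation_mat_def Pr_def Pc_def using s t by auto
  ultimately show ?thesis unfolding K_def by blast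
qed

lemma coprime_kronecker_decomposition_pair:
  assumes "coprime a b" "a > 0" "b > 0"
  shows "coprime_kronecker_decomposition (a * b) [a, b]"
  using fourier_mat_coprime_kronecker[OF assms] assms
  unfolding coprime_kronecker_decomposition_def kronecker_list_def
  by (auto simp: less_2_cases_iff kronecker_one_right coprime_commute simp flip: One_nat_def)

lemma factor_in_decomposition_iff: "factor_in_decomposition n as \<longleftrightarrow> n \<in> set as"
proof -
  have "fourier_mat n = fourier_mat a \<longleftrightarrow> n = a" for a
    by (metis carrier_matD(1) fourier_mat_carrier)
  then show ?thesis unfolding factor_in_decomposition_def by (auto simp: image_iff)
qed

lemma coprime_prod_list:
  fixes n :: nat
  assumes "\<And>a. a \<in> set as \<Longrightarrow> coprime n a"
  shows "coprime n (prod_list as)"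
  using assms by (induction as) auto

lemma coprime_kronecker_decomposition_cofactor:
  assumes "coprime_kronecker_decomposition m as" "factor_in_decomposition n as"
  obtains q where "m = n * q" "coprime n q"
proof -
  from assms(2) obtain xs ys where as: "as = xs @ n # ys"
    unfolding factor_in_decomposition_iff by (auto simp: in_set_conv_decomp)
  have co: "coprime (as ! i) (as ! j)" if "i < length as" "j < length as" "i \<noteq> j" for i j
    using assms(1) that unfolding coprime_kronecker_decomposition_def by blast
  have "coprime n a" if "a \<in> set (xs @ ys)" for a
  proof -
    from that consider i where "i < length xs" "a = xs ! i" | i where "i < length ys" "a = ys ! i"
      by (auto simp: in_set_conv_nth)
    then show ?thesis
    proof cases
      case 1
      with co[of "length xs" i] show ?thesis by (simp add: as nth_append)
    next
      case 2
      with co[of "length xs" "Suc (length xs + i)"] show ?thesis by (simp add: as nth_append)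
    qed
  qed
  then have "coprime n (prod_list (xs @ ys))" by (rule coprime_prod_list)
  moreover have "m = n * prod_list (xs @ ys)"
    using assms(1) unfolding coprime_kronecker_decomposition_def by (simp add: as mult_ac)
  ultimately show ?thesis using that by blast
qed

theorem proposition1p2:
  shows "(\<exists>n m :: nat. 0 < n \<and> n < m \<and>
            (\<exists>H. hadamard_submatrix_of_fourier n m H \<and>
                 \<not> hadamard_equivalent n H (fourier_mat n))) \<and>
         (\<exists>n m :: nat. 0 < n \<and> n < m \<and>
            (\<exists>as. coprime_kronecker_decomposition m as \<and> factor_in_decomposition n as) \<and>
            (\<exists>H. hadamard_submatrix_of_fourier n m H \<and>
                 \<not> hadamard_equivalent n H (fourier_mat n))) \<and>
         (\<exists>n m :: nat. 0 < n \<and> n < m \<and>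
            \<not> (\<exists>as. coprime_kronecker_decomposition m as \<and> factor_in_decomposition n as) \<and>
            (\<exists>H. hadamard_submatrix_of_fourier n m H \<and>
                 \<not> hadamard_equivalent n H (fourier_mat n)))"
proof -
  have "coprime (4 :: nat) 3"
    using coprime_Suc_left_nat[of 3] by simp
  then have "coprime_kronecker_decomposition 12 [4, 3]"
    using coprime_kronecker_decomposition_pair[of 4 3] by simp
  then have present: "\<exists>as. coprime_kronecker_decomposition 12 as \<and> factor_in_decomposition 4 as"
    by (auto simp: factor_in_decomposition_iff intro!: exI[of _ "[4, 3]"])
  have absent: "\<not> (\<exists>as. coprime_kronecker_decomposition 8 as \<and> factor_in_decomposition 4 as)"
  proof (clarify)
    fix as assume "coprime_kronecker_decomposition 8 as" "factor_in_decomposition 4 as"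
    then obtain q :: nat where "8 = 4 * q" "coprime 4 q"
      by (rule coprime_kronecker_decomposition_cofactor)
    then have "q = 2" "coprime 4 q" by simp_all
    then show False
      using coprime_common_divisor_nat[of 4 2 2] by simp
  qed
  have order_8: "\<exists>H. hadamard_submatrix_of_fourier 4 8 H \<and>
      \<not> hadamard_equivalent 4 H (fourier_mat 4)"
    and order_12: "\<exists>H. hadamard_submatrix_of_fourier 4 12 H \<and>
      \<not> hadamard_equivalent 4 H (fourier_mat 4)"
    by (rule inequivalent_submatrix_order_4; simp)+
  show ?thesis
  proof (intro conjI)
    show "\<exists>n m :: nat. 0 < n \<and> n < m \<and> (\<exists>H. hadamard_submatrix_of_fourier n m H \<and>
        \<not> hadamard_equivalent n H (fourier_mat n))"
      by (rule exI[of _ 4], rule exI[of _ 8]) (use order_8 in simp)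
    show "\<exists>n m :: nat. 0 < n \<and> n < m \<and>
        (\<exists>as. coprime_kronecker_decomposition m as \<and> factor_in_decomposition n as) \<and>
        (\<exists>H. hadamard_submatrix_of_fourier n m H \<and> \<not> hadamard_equivalent n H (fourier_mat n))"
      by (rule exI[of _ 4], rule exI[of _ 12]) (use order_12 present in simp)
    show "\<exists>n m :: nat. 0 < n \<and> n < m \<and>
        \<not> (\<exists>as. coprime_kronecker_decomposition m as \<and> factor_in_decomposition n as) \<and>
        (\<exists>H. hadamard_submatrix_of_fourier n m H \<and> \<not> hadamard_equivalent n H (fourier_mat n))"
      by (rule exI[of _ 4], rule exI[of _ 8]) (use order_8 absent in simp)
  qed
qed

end
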